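(* Let $\mathcal{H}$ be a real Hilbert space, $C\subset\mathcal{H}$ a nonempty, closed and convex set, and $f:\mathcal{H}\to\mathbb{R}$ a convex and Gateaux differentiable function such that $\nabla f$ is uniformly continuous on bounded sets. Assume that $\nabla f$ is bounded on bounded sets and that the solution set $S_*$ of the problem $\min\{f(x):x\in C\}$ is nonempty. Let $(x^k)_{k\in\mathbb{N}}$ be a sequence generated by Algorithm A2 (with $x^0\in C$, $\theta,\delta\in(0,1)$ and $(\beta_k)_{k\in\mathbb N}\subset[\check\beta,\hat\beta]$, $0<\check\beta\le\hat\beta<\infty$), with associated sets $H_k,W_k$, and let $x_*=P_{S_*}(x^0)$. Then: (i) $S_*\subseteq H_k\cap W_k\cap C$ for all $k$; (ii) $(x^k)_{k\in\mathbb{N}}$ is contained in the closed ball centered at $(x^0+x_* )/2$ with radius $\|x_*-x^0\|/2$; (iii) all weak cluster points of $(x^k)_{k\in\mathbb{N}}$ belong to $S_*$.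
   Context: $\nabla f(x)\in\mathcal{H}$ denotes the Gateaux derivative of $f$ at $x$ (the directional derivative satisfies $f'(x;d)=\langle\nabla f(x),d\rangle$ for all $d\in\mathcal{H}$). $P_K$ is the metric projection onto a nonempty closed convex set $K$. $S_*=\{x\in C: f(x)\le f(y)\ \forall y\in C\}$. Here $\mathbb{N}=\{0,1,2,\dots\}$. "$\nabla f$ is uniformly continuous (resp. bounded) on bounded sets" means that for each bounded $B\subset\mathcal{H}$ the restriction of $\nabla f$ to $B$ is uniformly continuous (resp. $\nabla f(B)$ is bounded). A weak cluster point of a sequence is the weak limit of one of its subsequences. Algorithm A2. Fix $\theta,\delta\in(0,1)$ and a sequence $(\beta_k)_{k\in\mathbb N}\subset[\check\beta,\hat\beta]$ with $0<\check\beta\le\hat\beta<\infty$. Take $x^0\in C$ and set $f^{lev}_{-1}=+\infty$. For $k=0,1,2,\dots$: given $x^k$, put $z^k=x^k-\beta_k\nabla f(x^k)$. If $x^k=P_C(z^k)$, stop. Otherwise let $$j(k)=\min\{j\in\mathbb{N} : f(x^{k,j})\le f(x^k)-\delta\theta^j\langle\nabla f(x^k),x^k-P_C(z^k)\rangle\},\qquad x^{k,j}=\theta^jP_C(z^k)+(1-\theta^j)x^k,$$ set $\alpha_k=\theta^{j(k)}$ and $f^{lev}_k=\min\{f^{lev}_{k-1},f(x^{k,j(k)})\}$, define $$H_k=\{x\in\mathcal{H}:\langle\nabla f(x^k),x-x^k\rangle+f(x^k)-f^{lev}_k\le0\},\qquad W_k=\{x\in\mathcal{H}:\langle x-x^k,x^0-x^k\rangle\le0\},$$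 and set $x^{k+1}=P_{C\cap W_k\cap H_k}(x^0)$. If $x^{k+1}=x^k$, stop. "A sequence $(x^k)_{k\in\mathbb{N}}$ generated by Algorithm A2" means an infinite sequence, i.e. the algorithm does not stop. *)

theory Defs
  imports "HOL-Analysis.Analysis"
begin

text \<open>
  A real Hilbert space is a type of sort \<open>{real_inner, complete_space}\<close>.
\<close>

text \<open>
  The one-sided limit is the directional derivative \<open>f'(x; d)\<close> of convex analysis. As it is
  required for all \<open>d\<close>, in particular for \<open>- d\<close>, the two-sided limit exists as well, and \<open>g\<close>
  is uniquely determined.
\<close>

definition has_gateaux_gradient :: "('a::real_inner \<Rightarrow> real) \<Rightarrow> 'a \<Rightarrow> 'a \<Rightarrow> bool" where
  "has_gateaux_gradient f g x \<longleftrightarrow>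
     (\<forall>d. ((\<lambda>t. (f (x + t *\<^sub>R d) - f x) / t) \<longlongrightarrow> g \<bullet> d) (at_right 0))"

text \<open>
  The library's \<^const>\<open>closest_point\<close> is restricted to Heine-Borel spaces and so does not
  cover infinite-dimensional Hilbert spaces.
\<close>

definition metric_proj :: "'a::metric_space set \<Rightarrow> 'a \<Rightarrow> 'a" where
  "metric_proj K a = (THE p. p \<in> K \<and> (\<forall>y\<in>K. dist a p \<le> dist a y))"

definition solution_set :: "('a \<Rightarrow> real) \<Rightarrow> 'a set \<Rightarrow> 'a set" where
  "solution_set f C = {x \<in> C. \<forall>y\<in>C. f x \<le> f y}"

definition weakly_converges_to :: "(nat \<Rightarrow> 'a::real_inner) \<Rightarrow> 'a \<Rightarrow> bool" where
  "weakly_converges_to u l \<longleftrightarrow> (\<forall>v. (\<lambda>n. u n \<bullet> v) \<longlonglongrightarrow> l \<bullet> v)"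

definition weak_cluster_point :: "(nat \<Rightarrow> 'a::real_inner) \<Rightarrow> 'a \<Rightarrow> bool" where
  "weak_cluster_point u l \<longleftrightarrow> (\<exists>r::nat \<Rightarrow> nat. strict_mono r \<and> weakly_converges_to (u \<circ> r) l)"

text \<open>
  \<open>line_point \<theta> p y j\<close> is the trial point \<open>x\<^bsup>k,j\<^esup>\<close> of the line search, for
  \<open>p = P\<^sub>C(z\<^sup>k)\<close> and \<open>y = x\<^sup>k\<close>.
\<close>

definition line_point :: "real \<Rightarrow> 'a::real_vector \<Rightarrow> 'a \<Rightarrow> nat \<Rightarrow> 'a" where
  "line_point \<theta> p y j = \<theta> ^ j *\<^sub>R p + (1 - \<theta> ^ j) *\<^sub>R y"

text \<open>
  An infinite run of the algorithm: \<open>x\<close> are the iterates, \<open>j\<close> the line search indices,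
  \<open>lev\<close> the levels, and \<open>H\<close>, \<open>W\<close> the half-spaces; \<open>Df\<close> is the gradient map of \<open>f\<close>.
  The two disequations say that neither stopping test ever succeeds. The initial level
  \<open>+\<infinity>\<close> is not represented: the minimum of \<open>+\<infinity>\<close> and a real number is that number, so the
  level at index \<open>0\<close> is just the first trial value.
\<close>

definition generated_by_A2 ::
  "('a::real_inner \<Rightarrow> real) \<Rightarrow> ('a \<Rightarrow> 'a) \<Rightarrow> 'a set \<Rightarrow> real \<Rightarrow> real \<Rightarrow> (nat \<Rightarrow> real) \<Rightarrow>
   (nat \<Rightarrow> 'a) \<Rightarrow> (nat \<Rightarrow> nat) \<Rightarrow> (nat \<Rightarrow> real) \<Rightarrow> (nat \<Rightarrow> 'a set) \<Rightarrow> (nat \<Rightarrow> 'a set) \<Rightarrow> bool" where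
  "generated_by_A2 f Df C \<theta> \<delta> \<beta> x j lev H W \<longleftrightarrow>
     x 0 \<in> C \<and>
     (\<forall>k. let z = x k - \<beta> k *\<^sub>R Df (x k);
              p = metric_proj C z;
              trial = f (line_point \<theta> p (x k) (j k))
          in x k \<noteq> p \<and>
             j k = (LEAST i. f (line_point \<theta> p (x k) i)
                               \<le> f (x k) - \<delta> * \<theta> ^ i * (Df (x k) \<bullet> (x k - p))) \<and>
             lev k = (if k = 0 then trial else min (lev (k - 1)) trial) \<and>
             H k = {y. Df (x k) \<bullet> (y - x k) + f (x k) - lev k \<le> 0} \<and>
             W k = {y. (y - x k) \<bullet> (x 0 - x k) \<le> 0} \<and>
             x (Suc k) = metric_proj (C \<inter> W k \<inter> H k) (x 0) \<and>
             x (Suc k) \<noteq> x k)"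

end

theory Submission
  imports Defs
begin

text \<open>
  The iterate \<open>x\<^sup>k\<close> is the projection of \<open>x\<^sup>0\<close> onto \<open>W\<^sub>k\<close>, and \<open>x\<^bsup>k+1\<^esup> \<in> W\<^sub>k\<close>; hence the distances
  to \<open>x\<^sup>0\<close> increase, and by Pythagoras consecutive iterates approach each other. Since
  \<open>x\<^bsup>k+1\<^esup> \<in> H\<^sub>k\<close>, the decrease guaranteed by the line search tends to zero, and uniform continuity
  of the gradient turns this into \<open>x\<^sup>k - P\<^sub>C(z\<^sup>k) \<rightarrow> 0\<close>. The variational inequality for
  \<open>P\<^sub>C(z\<^sup>k)\<close> and the gradient inequality then bound \<open>f(x\<^sup>k) - f(y)\<close>, for every \<open>y \<in> C\<close>, by a null
  sequence, and closed sublevel sets of \<open>f\<close> and \<open>C\<close> itself are intersections of half-spaces, so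
  they contain weak limits.
\<close>

section \<open>Metric projection in a Hilbert space\<close>

text \<open>The parallelogram law for \<open>a - y\<close> and \<open>a - z\<close>: the midpoint of
  \<open>y\<close> and \<open>z\<close> lies in \<open>S\<close> by convexity and is therefore at
  least \<open>infdist a S\<close> away from \<open>a\<close>.\<close>

lemma near_minimizers_close:
  fixes S :: "'a::real_inner set"
  assumes "convex S" "y \<in> S" "z \<in> S" and le: "dist a y \<le> r" "dist a z \<le> r"
  shows "(dist y z)\<^sup>2 \<le> 4 * r\<^sup>2 - 4 * (infdist a S)\<^sup>2"
proof -
  have "(1/2) *\<^sub>R y + (1/2) *\<^sub>R z \<in> S"
    using assms by (intro convexD) auto
  then have "infdist a S \<le> dist a ((1/2) *\<^sub>R y + (1/2) *\<^sub>R z)"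
    by (rule infdist_le)
  then have "(infdist a S)\<^sup>2 \<le> (dist a ((1/2) *\<^sub>R y + (1/2) *\<^sub>R z))\<^sup>2"
    by (intro power_mono infdist_nonneg)
  moreover have "(dist y z)\<^sup>2 = 2 * (dist a y)\<^sup>2 + 2 * (dist a z)\<^sup>2
      - 4 * (dist a ((1/2) *\<^sub>R y + (1/2) *\<^sub>R z))\<^sup>2"
    by (simp add: dist_norm power2_norm_eq_inner algebra_simps inner_commute)
  moreover have "(dist a y)\<^sup>2 \<le> r\<^sup>2" "(dist a z)\<^sup>2 \<le> r\<^sup>2"
    using le by (auto intro: power_mono)
  ultimately show ?thesis by linarith
qed

text \<open>Cantor's intersection theorem: the points of \<open>S\<close> within
  \<open>d + 1/(n+1)\<close> of \<open>a\<close> form decreasing closed sets whose diameters vanish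
  by \<open>near_minimizers_close\<close>.\<close>

lemma nearest_point_exists:
  fixes S :: "'a::{real_inner, complete_space} set"
  assumes "closed S" "convex S" "S \<noteq> {}"
  shows "\<exists>p\<in>S. \<forall>y\<in>S. dist a p \<le> dist a y"
proof -
  define d where "d = infdist a S"
  define T where "T n = S \<inter> cball a (d + inverse (real (Suc n)))" for n
  have "\<exists>p. \<forall>n. p \<in> T n"
  proof (rule decreasing_closed_nest)
    show "closed (T n)" for n
      unfolding T_def using assms by auto
    show "T n \<noteq> {}" for n
    proof -
      have "infdist a S < d + inverse (real (Suc n))"
        by (simp add: d_def)
      then obtain y where "y \<in> S" "dist a y < d + inverse (real (Suc n))"
        using assms(3) cInf_lessD[of "dist a ` S"] by (auto simp: infdist_def)
      then show ?thesis
        by (auto simp: T_def)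
    qed
    show "T n \<subseteq> T m" if "m \<le> n" for m n
    proof -
      have "inverse (real (Suc n)) \<le> inverse (real (Suc m))"
        using that by (intro le_imp_inverse_le) auto
      then show ?thesis
        unfolding T_def by (intro Int_mono subset_cball) auto
    qed
    show "\<exists>n. \<forall>y\<in>T n. \<forall>z\<in>T n. dist y z < e" if "e > 0" for e
    proof -
      have "(\<lambda>n. 4 * (d + inverse (real (Suc n)))\<^sup>2 - 4 * d\<^sup>2) \<longlonglongrightarrow> 4 * (d + 0)\<^sup>2 - 4 * d\<^sup>2"
        by (intro tendsto_intros LIMSEQ_inverse_real_of_nat)
      then have "\<forall>\<^sub>F n in sequentially. 4 * (d + inverse (real (Suc n)))\<^sup>2 - 4 * d\<^sup>2 < e\<^sup>2"
        using that by (intro order_tendstoD(2)) auto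
      then obtain n where n: "4 * (d + inverse (real (Suc n)))\<^sup>2 - 4 * d\<^sup>2 < e\<^sup>2"
        by (auto simp: eventually_sequentially)
      have "dist y z < e" if "y \<in> T n" "z \<in> T n" for y z
      proof -
        have "(dist y z)\<^sup>2 \<le> 4 * (d + inverse (real (Suc n)))\<^sup>2 - 4 * d\<^sup>2"
          using near_minimizers_close[OF assms(2)] that by (auto simp: T_def d_def)
        with n have "(dist y z)\<^sup>2 < e\<^sup>2" by linarith
        then show ?thesis
          by (rule power2_less_imp_less) (use \<open>e > 0\<close> in simp)
      qed
      then show ?thesis by blast
    qed
  qed auto
  then obtain p where p: "p \<in> T n" for n by blast
  have "dist a p \<le> d"
  proof (rule field_le_epsilon)
    fix e :: real assume "e > 0"
    then obtain n where "inverse (real (Suc n)) < e"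
      using reals_Archimedean by blast
    with p[of n] show "dist a p \<le> d + e"
      by (auto simp: T_def)
  qed
  then have "dist a p \<le> dist a y" if "y \<in> S" for y
    using infdist_le[OF that, of a] by (simp add: d_def)
  moreover have "p \<in> S"
    using p[of 0] by (simp add: T_def)
  ultimately show ?thesis by blast
qed

text \<open>Two nearest points are both at distance \<open>infdist a S\<close>, so
  \<open>near_minimizers_close\<close> makes them coincide and the definite description is
  legitimate.\<close>

lemma metric_proj_nearest:
  fixes S :: "'a::{real_inner, complete_space} set"
  assumes "closed S" "convex S" "S \<noteq> {}"
  shows "metric_proj S a \<in> S \<and> (\<forall>y\<in>S. dist a (metric_proj S a) \<le> dist a y)"
  unfolding metric_proj_def
proof (rule theI', rule ex_ex1I)
  show "\<exists>p. p \<in> S \<and> (\<forall>y\<in>S. dist a p \<le> dist a y)"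
    using nearest_point_exists[OF assms] by (simp add: Bex_def)
  fix p q
  assume p: "p \<in> S \<and> (\<forall>y\<in>S. dist a p \<le> dist a y)"
    and q: "q \<in> S \<and> (\<forall>y\<in>S. dist a q \<le> dist a y)"
  have "dist a p \<le> infdist a S"
    using p assms(3) by (auto simp: infdist_def intro!: cINF_greatest)
  then have eq: "dist a p = infdist a S"
    using p infdist_le[of p S a] by linarith
  have "(dist p q)\<^sup>2 \<le> 4 * (dist a p)\<^sup>2 - 4 * (infdist a S)\<^sup>2"
    using p q by (intro near_minimizers_close[OF assms(2)]) auto
  with eq show "p = q" by simp
qed

lemma metric_proj_in:
  fixes S :: "'a::{real_inner, complete_space} set"
  assumes "closed S" "convex S" "S \<noteq> {}"
  shows "metric_proj S a \<in> S"
  using metric_proj_nearest[OF assms] by blast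

text \<open>A small move from the projection towards \<open>y\<close> stays in \<open>S\<close> and
  so cannot come nearer to \<open>a\<close>.\<close>

lemma metric_proj_obtuse:
  fixes S :: "'a::{real_inner, complete_space} set"
  assumes "closed S" "convex S" "y \<in> S"
  shows "(a - metric_proj S a) \<bullet> (y - metric_proj S a) \<le> 0"
proof -
  define p where "p = metric_proj S a"
  have "S \<noteq> {}" using assms(3) by blast
  with assms have p: "p \<in> S" "\<forall>y\<in>S. dist a p \<le> dist a y"
    using metric_proj_nearest[of S a] by (auto simp: p_def)
  show ?thesis
    unfolding p_def[symmetric]
    using any_closest_point_dot[OF assms(2,1) p(1) assms(3) p(2)] .
qed

section \<open>Convex functions with a Gateaux gradient\<close>

text \<open>Convexity bounds the difference quotients with \<open>0 < t < 1\<close> by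
  \<open>f y - f x\<close>; then \<open>t\<close> tends to 0.\<close>

lemma gradient_inequality:
  assumes conv: "convex_on UNIV f" and grad: "has_gateaux_gradient f g x"
  shows "f x + g \<bullet> (y - x) \<le> f y"
proof -
  have "((\<lambda>t. (f (x + t *\<^sub>R (y - x)) - f x) / t) \<longlongrightarrow> g \<bullet> (y - x)) (at_right 0)"
    using grad by (simp add: has_gateaux_gradient_def)
  moreover have "\<forall>\<^sub>F t in at_right 0. (f (x + t *\<^sub>R (y - x)) - f x) / t \<le> f y - f x"
    unfolding eventually_at_right_field
  proof (intro exI[of _ 1] conjI allI impI)
    fix t :: real assume t: "0 < t" "t < 1"
    have "f ((1 - t) *\<^sub>R x + t *\<^sub>R y) \<le> (1 - t) * f x + t * f y"
      using t by (intro convex_onD[OF conv]) auto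
    moreover have "(1 - t) *\<^sub>R x + t *\<^sub>R y = x + t *\<^sub>R (y - x)"
      by (simp add: algebra_simps)
    ultimately have "f (x + t *\<^sub>R (y - x)) - f x \<le> (f y - f x) * t"
      by (simp add: algebra_simps)
    then show "(f (x + t *\<^sub>R (y - x)) - f x) / t \<le> f y - f x"
      using t by (simp add: divide_le_eq)
  qed simp
  ultimately have "g \<bullet> (y - x) \<le> f y - f x"
    by (rule tendsto_upperbound) simp
  then show ?thesis by simp
qed

text \<open>One inclusion is the gradient inequality; for the other, the half-space with index
  \<open>y = x\<close> suffices.\<close>

lemma sublevel_eq_Inter_halfspaces:
  assumes "convex_on UNIV f" and "\<And>y. has_gateaux_gradient f (Df y) y"
  shows "{x. f x \<le> m} = (\<Inter>y. {x. Df y \<bullet> x \<le> m - f y + Df y \<bullet> y})"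
proof (intro set_eqI iffI)
  fix x assume "x \<in> {x. f x \<le> m}"
  then have "Df y \<bullet> x \<le> m - f y + Df y \<bullet> y" for y
    using gradient_inequality[OF assms, of y x] by (simp add: inner_diff_right)
  then show "x \<in> (\<Inter>y. {x. Df y \<bullet> x \<le> m - f y + Df y \<bullet> y})"
    by blast
next
  fix x assume "x \<in> (\<Inter>y. {x. Df y \<bullet> x \<le> m - f y + Df y \<bullet> y})"
  then have "Df x \<bullet> x \<le> m - f x + Df x \<bullet> x"
    by blast
  then show "x \<in> {x. f x \<le> m}"
    by simp
qed

text \<open>Needed for the projection onto the solution set to exist. The set is \<open>C\<close>
  cut by the sublevel sets at the levels \<open>f c\<close>.\<close>

lemma solution_set_closed_convex:
  assumes "convex_on UNIV f" and "\<And>y. has_gateaux_gradient f (Df y) y"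
    and "closed C" "convex C"
  shows "closed (solution_set f C)" "convex (solution_set f C)"
proof -
  have "solution_set f C = C \<inter> (\<Inter>c\<in>C. {x. f x \<le> f c})"
    by (auto simp: solution_set_def)
  then have eq: "solution_set f C =
      C \<inter> (\<Inter>c\<in>C. \<Inter>y. {x. Df y \<bullet> x \<le> f c - f y + Df y \<bullet> y})"
    by (simp add: sublevel_eq_Inter_halfspaces[OF assms(1,2)])
  show "closed (solution_set f C)" "convex (solution_set f C)"
    unfolding eq
    by (intro closed_Int closed_INT ballI assms closed_halfspace_le,
        intro convex_Int convex_INT assms convex_halfspace_le)
qed

text \<open>The bound may vary with \<open>n\<close>, so that points which are optimal only up to a
  null sequence can be treated.\<close>

lemma weak_limit_halfspace:
  assumes "weakly_converges_to u l" and "\<And>n. a \<bullet> u n \<le> b n" and "b \<longlonglongrightarrow> c"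
  shows "a \<bullet> l \<le> c"
proof (rule LIMSEQ_le)
  show "(\<lambda>n. a \<bullet> u n) \<longlonglongrightarrow> a \<bullet> l"
    using assms(1) by (simp add: weakly_converges_to_def inner_commute)
qed (use assms in auto)

text \<open>The half-space with normal \<open>l - p\<close> bounded at the projection
  \<open>p\<close> of \<open>l\<close> contains every \<open>u n\<close>, hence also
  \<open>l\<close>; this forces \<open>l = p\<close>.\<close>

lemma weak_limit_in_closed_convex:
  fixes C :: "'a::{real_inner, complete_space} set"
  assumes "closed C" "convex C" "weakly_converges_to u l" "\<And>n. u n \<in> C"
  shows "l \<in> C"
proof -
  define p where "p = metric_proj C l"
  have "(l - p) \<bullet> l \<le> (l - p) \<bullet> p"
  proof (rule weak_limit_halfspace[OF assms(3)])
    show "(l - p) \<bullet> u n \<le> (l - p) \<bullet> p" for n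
      using metric_proj_obtuse[OF assms(1,2,4), of l n] by (simp add: p_def inner_diff_right)
  qed simp
  then have "(l - p) \<bullet> (l - p) \<le> 0"
    by (simp add: inner_diff_right)
  then have "l = p"
    using inner_ge_zero[of "l - p"] by (metis eq_iff_diff_eq_0 inner_eq_zero_iff order_antisym)
  then show ?thesis
    using metric_proj_in[OF assms(1,2)] assms(4) by (metis empty_iff p_def)
qed

section \<open>The line search\<close>

lemma line_point_eq: "line_point \<theta> p y i = y + \<theta> ^ i *\<^sub>R (p - y)"
  by (simp add: line_point_def algebra_simps)

text \<open>As \<open>\<theta> ^ i\<close> decreases to 0, the difference quotients tend to
  \<open>- (g \<bullet> (y - p))\<close>, which lies strictly below the slope demanded by the test
  because \<delta> < 1.\<close>

lemma line_search_terminates: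
  assumes grad: "has_gateaux_gradient f g y" and "0 < \<theta>" "\<theta> < 1" "\<delta> < 1"
    and descent: "0 < g \<bullet> (y - p)"
  shows "\<exists>i. f (line_point \<theta> p y i) \<le> f y - \<delta> * \<theta> ^ i * (g \<bullet> (y - p))"
proof -
  have "((\<lambda>t. (f (y + t *\<^sub>R (p - y)) - f y) / t) \<longlongrightarrow> g \<bullet> (p - y)) (at_right 0)"
    using grad by (simp add: has_gateaux_gradient_def)
  moreover have "filterlim (\<lambda>i. \<theta> ^ i) (at_right 0) sequentially"
    unfolding filterlim_at using assms(2,3) by (auto intro: LIMSEQ_power_zero)
  ultimately have "(\<lambda>i. (f (y + \<theta> ^ i *\<^sub>R (p - y)) - f y) / \<theta> ^ i) \<longlonglongrightarrow> g \<bullet> (p - y)"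
    by (rule filterlim_compose)
  moreover have "g \<bullet> (p - y) < - \<delta> * (g \<bullet> (y - p))"
  proof -
    have "\<delta> * (g \<bullet> (y - p)) < 1 * (g \<bullet> (y - p))"
      using assms by (intro mult_strict_right_mono) auto
    then show ?thesis by (simp add: inner_diff_right)
  qed
  ultimately have "\<forall>\<^sub>F i in sequentially.
      (f (y + \<theta> ^ i *\<^sub>R (p - y)) - f y) / \<theta> ^ i < - \<delta> * (g \<bullet> (y - p))"
    by (rule order_tendstoD(2))
  then obtain i where "(f (y + \<theta> ^ i *\<^sub>R (p - y)) - f y) / \<theta> ^ i < - \<delta> * (g \<bullet> (y - p))"
    by (auto simp: eventually_sequentially)
  then have "f (y + \<theta> ^ i *\<^sub>R (p - y)) - f y < - \<delta> * (g \<bullet> (y - p)) * \<theta> ^ i"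
    using \<open>0 < \<theta>\<close> by (simp add: divide_less_eq)
  then show ?thesis
    by (intro exI[of _ i]) (simp add: line_point_eq algebra_simps)
qed

text \<open>Linearising at the rejected point shows that the slope along \<open>y - p\<close> is
  there less than \<delta> times the slope at \<open>y\<close>, so the gradient must have changed in
  between.\<close>

lemma rejected_trial_gradient_gap:
  assumes conv: "convex_on UNIV f" and grad: "has_gateaux_gradient f h (line_point \<theta> p y i)"
    and "0 < \<theta>"
    and rejected: "f y - \<delta> * \<theta> ^ i * (g \<bullet> (y - p)) < f (line_point \<theta> p y i)"
  shows "(1 - \<delta>) * (g \<bullet> (y - p)) \<le> norm (g - h) * norm (y - p)"
proof -
  have "f (line_point \<theta> p y i) + h \<bullet> (y - line_point \<theta> p y i) \<le> f y"
    by (rule gradient_inequality[OF conv grad])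
  moreover have "y - line_point \<theta> p y i = \<theta> ^ i *\<^sub>R (y - p)"
    by (simp add: line_point_eq algebra_simps)
  ultimately have "\<theta> ^ i * (h \<bullet> (y - p)) < \<theta> ^ i * (\<delta> * (g \<bullet> (y - p)))"
    using rejected by (simp add: algebra_simps)
  then have "h \<bullet> (y - p) < \<delta> * (g \<bullet> (y - p))"
    using \<open>0 < \<theta>\<close> by simp
  then have "(1 - \<delta>) * (g \<bullet> (y - p)) \<le> (g - h) \<bullet> (y - p)"
    by (simp add: inner_diff_left algebra_simps)
  also have "\<dots> \<le> norm (g - h) * norm (y - p)"
    by (rule norm_cauchy_schwarz)
  finally show ?thesis .
qed

text \<open>The variational inequality of the projection, tested with \<open>y\<close>
  itself.\<close>

lemma projected_step_descent:
  fixes C :: "'a::{real_inner, complete_space} set"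
  assumes "closed C" "convex C" "y \<in> C" and p: "p = metric_proj C (y - b *\<^sub>R g)"
  shows "(norm (y - p))\<^sup>2 \<le> b * (g \<bullet> (y - p))"
  using metric_proj_obtuse[OF assms(1-3), of "y - b *\<^sub>R g"]
  by (simp add: p[symmetric] power2_norm_eq_inner algebra_simps)

section \<open>The algorithm\<close>

theorem lemma4p2:
  fixes f :: "'a::{real_inner, complete_space} \<Rightarrow> real"
    and Df :: "'a \<Rightarrow> 'a"
    and C :: "'a set"
    and \<theta> \<delta> \<beta>lo \<beta>hi :: real
    and \<beta> :: "nat \<Rightarrow> real"
    and x :: "nat \<Rightarrow> 'a"
    and j :: "nat \<Rightarrow> nat"
    and lev :: "nat \<Rightarrow> real"
    and H W :: "nat \<Rightarrow> 'a set"
    and xs :: 'a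
  assumes "C \<noteq> {}" and "closed C" and "convex C"
    and "convex_on UNIV f"
    and "\<And>y. has_gateaux_gradient f (Df y) y"
    and "\<And>B. bounded B \<Longrightarrow> uniformly_continuous_on B Df"
    and "\<And>B. bounded B \<Longrightarrow> bounded (Df ` B)"
    and "solution_set f C \<noteq> {}"
    and "0 < \<theta>" and "\<theta> < 1" and "0 < \<delta>" and "\<delta> < 1"
    and "0 < \<beta>lo" and "\<beta>lo \<le> \<beta>hi" and "\<And>k. \<beta> k \<in> {\<beta>lo..\<beta>hi}"
    and "generated_by_A2 f Df C \<theta> \<delta> \<beta> x j lev H W"
    and "xs = metric_proj (solution_set f C) (x 0)"
  shows "(\<forall>k. solution_set f C \<subseteq> H k \<inter> W k \<inter> C)
    \<and> range x \<subseteq> cball ((1/2) *\<^sub>R (x 0 + xs)) (norm (xs - x 0) / 2)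
    \<and> (\<forall>l. weak_cluster_point x l \<longrightarrow> l \<in> solution_set f C)"
proof -

  \<comment> \<open>Notation and the unfolded recursion\<close>
  define S where "S = solution_set f C"
  define p where "p k = metric_proj C (x k - \<beta> k *\<^sub>R Df (x k))" for k
  define D where "D k = Df (x k) \<bullet> (x k - p k)" for k
  have \<beta>: "\<beta>lo \<le> \<beta> k" "\<beta> k \<le> \<beta>hi" "0 < \<beta> k" for k
    using assms(13) assms(15)[of k] by auto
  have x0: "x 0 \<in> C"
    and ne: "x k \<noteq> p k"
    and j: "j k = (LEAST i. f (line_point \<theta> (p k) (x k) i) \<le> f (x k) - \<delta> * \<theta> ^ i * D k)"
    and lev: "lev k = (if k = 0 then f (line_point \<theta> (p k) (x k) (j k))
                 else min (lev (k - 1)) (f (line_point \<theta> (p k) (x k) (j k))))"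
    and H: "H k = {y. Df (x k) \<bullet> (y - x k) + f (x k) - lev k \<le> 0}"
    and W: "W k = {y. (y - x k) \<bullet> (x 0 - x k) \<le> 0}"
    and x_Suc: "x (Suc k) = metric_proj (C \<inter> W k \<inter> H k) (x 0)" for k
    using assms(16) unfolding generated_by_A2_def Let_def p_def D_def by blast+
  note grad_ineq = gradient_inequality[OF assms(4,5)]
  note proj_C = metric_proj_in[OF assms(2,3,1)]

  have "W k = {y. (x 0 - x k) \<bullet> y \<le> (x 0 - x k) \<bullet> x k}"
    "H k = {y. Df (x k) \<bullet> y \<le> lev k - f (x k) + Df (x k) \<bullet> x k}" for k
    by (auto simp: W H inner_diff_right inner_diff_left inner_commute)
  then have cc: "closed (C \<inter> W k \<inter> H k)" "convex (C \<inter> W k \<inter> H k)" for k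
    using assms(2,3)
    by (auto intro!: closed_Int convex_Int closed_halfspace_le convex_halfspace_le)

  \<comment> \<open>Claim (i): solutions are never cut off\<close>
  have p_C: "p k \<in> C" for k
    unfolding p_def by (rule proj_C)

  have trial_C: "line_point \<theta> (p k) (x k) i \<in> C" if "x k \<in> C" for k i
    unfolding line_point_def using assms(3,9,10) p_C that
    by (intro convexD) (auto intro: power_le_one)

  \<comment> \<open>The linearisation at \<open>x k\<close> stays below \<open>f\<close>, so a level
    that is at least \<open>f s\<close> cannot cut off \<open>s\<close>.\<close>
  have S_H_if: "S \<subseteq> H k" if "\<forall>s\<in>S. f s \<le> lev k" for k
  proof
    fix s assume "s \<in> S"
    with that have "f s \<le> lev k" by blast
    with grad_ineq[of "x k" s] show "s \<in> H k"
      by (simp add: H)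
  qed

  \<comment> \<open>A joint induction: \<open>S\<close> makes the intersection nonempty, so the next
    iterate lies in \<open>C\<close>; then its trial points lie in \<open>C\<close> and keep the
    level above the optimal value.\<close>
  have main: "x k \<in> C \<and> S \<subseteq> W k \<and> S \<subseteq> H k \<and> (\<forall>s\<in>S. f s \<le> lev k)" for k
  proof (induction k)
    case 0
    have lev0: "\<forall>s\<in>S. f s \<le> lev 0"
      using trial_C[OF x0] by (auto simp: lev S_def solution_set_def)
    then have "S \<subseteq> H 0"
      by (rule S_H_if)
    \<comment> \<open>\<open>W 0\<close> is the whole space.\<close>
    with lev0 show ?case
      by (auto simp: x0 W)
  next
    case (Suc k)
    have sub: "S \<subseteq> C \<inter> W k \<inter> H k"
      using Suc by (auto simp: S_def solution_set_def)
    have "x (Suc k) \<in> C \<inter> W k \<inter> H k"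
      unfolding x_Suc using sub assms(8) by (intro metric_proj_in cc) (auto simp: S_def)
    then have xC: "x (Suc k) \<in> C" by blast
    \<comment> \<open>The variational inequality for the projection onto
      \<open>C \<inter> W k \<inter> H k\<close> is the membership condition of
      \<open>W (Suc k)\<close>.\<close>
    have "S \<subseteq> W (Suc k)"
    proof
      fix s assume "s \<in> S"
      with sub have "(x 0 - x (Suc k)) \<bullet> (s - x (Suc k)) \<le> 0"
        unfolding x_Suc by (intro metric_proj_obtuse cc) blast
      then show "s \<in> W (Suc k)"
        by (simp add: W inner_commute)
    qed
    moreover have lev': "\<forall>s\<in>S. f s \<le> lev (Suc k)"
      using Suc trial_C[OF xC] lev[of "Suc k"] by (auto simp: S_def solution_set_def)
    moreover have "S \<subseteq> H (Suc k)"
      using lev' by (rule S_H_if)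
    ultimately show ?case using xC by blast
  qed
  then have x_C: "x k \<in> C" and S_W: "S \<subseteq> W k" and S_H: "S \<subseteq> H k" for k
    by auto
  have S_C: "S \<subseteq> C"
    by (auto simp: S_def solution_set_def)

  \<comment> \<open>Claim (ii): the ball\<close>
  have xs: "xs \<in> S"
    unfolding assms(17) S_def
    using solution_set_closed_convex[OF assms(4,5,2,3)] assms(8) by (rule metric_proj_in)
  have ball: "x k \<in> cball ((1/2) *\<^sub>R (x 0 + xs)) (norm (xs - x 0) / 2)" for k
  proof -
    \<comment> \<open>By Thales, this product is nonpositive exactly when \<open>x k\<close> lies in
      the ball with the segment from \<open>x 0\<close> to \<open>xs\<close> as diameter.\<close>
    have "(xs - x k) \<bullet> (x 0 - x k) \<le> 0"
      using S_W xs by (auto simp: W)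
    then have "(norm ((1/2) *\<^sub>R (x 0 + xs) - x k))\<^sup>2 \<le> (norm (xs - x 0) / 2)\<^sup>2"
      by (simp add: power2_norm_eq_inner power_divide algebra_simps inner_commute)
    then have "norm ((1/2) *\<^sub>R (x 0 + xs) - x k) \<le> norm (xs - x 0) / 2"
      by (rule power2_le_imp_le) simp
    then show ?thesis by (simp add: dist_norm)
  qed

  have x_Suc_in: "x (Suc k) \<in> W k \<inter> H k" for k
  proof -
    have "x (Suc k) \<in> C \<inter> W k \<inter> H k"
      unfolding x_Suc
    proof (intro metric_proj_in cc)
      have "xs \<in> C \<inter> W k \<inter> H k"
        using S_W[of k] S_H[of k] S_C xs by blast
      then show "C \<inter> W k \<inter> H k \<noteq> {}" by blast
    qed
    then show ?thesis by blast
  qed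

  \<comment> \<open>Bounds on the iterates and vanishing steps\<close>
  have bdd_x: "bounded (range x)"
    using ball by (intro bounded_subset[OF bounded_cball]) blast
  obtain X where X: "norm (x k) \<le> X" for k
    using bdd_x by (auto simp: bounded_iff)
  obtain G where G: "norm (Df (x k)) \<le> G" for k
    using assms(7)[OF bdd_x] by (auto simp: bounded_iff)
  have Df_le: "\<bar>Df (x k) \<bullet> v\<bar> \<le> G * norm v" for k v
  proof -
    have "\<bar>Df (x k) \<bullet> v\<bar> \<le> norm (Df (x k)) * norm v"
      by (rule Cauchy_Schwarz_ineq2)
    also have "\<dots> \<le> G * norm v"
      by (intro mult_right_mono G norm_ge_zero)
    finally show ?thesis .
  qed

  define E where "E k = (norm (x k - x 0))\<^sup>2" for k
  \<comment> \<open>The law of cosines in the triangle \<open>x 0\<close>, \<open>x k\<close>,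
    \<open>x (Suc k)\<close>: membership in \<open>W k\<close> gives the cross term its
    sign.\<close>
  have pyth: "(norm (x (Suc k) - x k))\<^sup>2 \<le> E (Suc k) - E k" for k
  proof -
    have "(x (Suc k) - x k) \<bullet> (x 0 - x k) \<le> 0"
      using x_Suc_in by (auto simp: W)
    then show ?thesis
      by (simp add: E_def power2_norm_eq_inner algebra_simps inner_commute)
  qed
  \<comment> \<open>\<open>E\<close> is increasing and bounded, so its increments, which dominate
    the squared steps, tend to 0.\<close>
  have "convergent E"
  proof (rule Bseq_mono_convergent)
    have "norm (E k) \<le> (X + X)\<^sup>2" for k
    proof -
      have "norm (x k - x 0) \<le> X + X"
        using norm_triangle_ineq4[of "x k" "x 0"] X[of k] X[of 0] by linarith
      then have "(norm (x k - x 0))\<^sup>2 \<le> (X + X)\<^sup>2"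
        by (rule power_mono) simp
      then show ?thesis
        by (simp add: E_def)
    qed
    then show "Bseq E" by (rule BseqI')
    have "E k \<le> E (Suc k)" for k
      using pyth[of k] zero_le_power2[of "norm (x (Suc k) - x k)"] by linarith
    then show "\<forall>m n. m \<le> n \<longrightarrow> E m \<le> E n"
      by (simp add: lift_Suc_mono_le)
  qed
  then obtain e where "E \<longlonglongrightarrow> e" by (auto simp: convergent_def)
  then have dE: "(\<lambda>k. E (Suc k) - E k) \<longlonglongrightarrow> e - e"
    by (intro tendsto_diff LIMSEQ_Suc)
  have sq: "(\<lambda>k. (norm (x (Suc k) - x k))\<^sup>2) \<longlonglongrightarrow> 0"
    by (rule tendsto_sandwich[OF _ _ tendsto_const dE[simplified]]) (use pyth in simp_all)
  have steps: "(\<lambda>k. norm (x (Suc k) - x k)) \<longlonglongrightarrow> 0"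
    using tendsto_real_sqrt[OF sq] by simp

  \<comment> \<open>Residuals of the projected gradient step\<close>
  define r where "r k = norm (x k - p k)" for k
  have r0: "0 < r k" for k
    using ne by (simp add: r_def)
  have r_sq: "(r k)\<^sup>2 \<le> \<beta> k * D k" for k
    unfolding r_def D_def by (rule projected_step_descent[OF assms(2,3) x_C p_def])
  have D0: "0 < D k" for k
  proof -
    have "0 < \<beta> k * D k"
      using r_sq[of k] r0[of k] by (meson less_le_trans zero_less_power)
    then show ?thesis
      using \<beta>[of k] by (simp add: zero_less_mult_iff)
  qed
  have r_D: "(r k)\<^sup>2 \<le> \<beta>hi * D k" for k
    using r_sq[of k] \<beta>[of k] D0[of k] by (meson less_imp_le mult_right_mono order_trans)
  \<comment> \<open>This confines all trial points to one fixed ball, on which uniform continuity of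
    \<open>Df\<close> can be used.\<close>
  have r_bound: "r k \<le> \<beta>hi * G" for k
  proof -
    have "D k \<le> G * r k"
      using Df_le[of k "x k - p k"] by (simp add: D_def r_def)
    then have "\<beta>hi * D k \<le> \<beta>hi * (G * r k)"
      using assms(13,14) by (intro mult_left_mono) auto
    with r_D[of k] have "r k * r k \<le> \<beta>hi * G * r k"
      by (simp add: power2_eq_square)
    then show ?thesis using r0[of k] by simp
  qed

  \<comment> \<open>\<open>LEAST\<close> satisfies the test only once some index is known to pass
    it.\<close>
  have accepted: "f (line_point \<theta> (p k) (x k) (j k)) \<le> f (x k) - \<delta> * \<theta> ^ j k * D k" for k
  proof -
    have "\<exists>i. f (line_point \<theta> (p k) (x k) i) \<le> f (x k) - \<delta> * \<theta> ^ i * D k"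
      unfolding D_def
      by (rule line_search_terminates[OF assms(5,9,10,12)]) (use D0[of k] in \<open>simp add: D_def\<close>)
    from LeastI_ex[OF this] show ?thesis
      by (simp only: j[symmetric])
  qed
  have "(\<lambda>k. \<theta> ^ j k * D k) \<longlonglongrightarrow> 0"
  proof (rule tendsto_sandwich)
    \<comment> \<open>Since \<open>x (Suc k)\<close> lies in \<open>H k\<close>, the gap
      \<open>f (x k) - lev k\<close>, which is at least the accepted decrease, is controlled by the
      step length.\<close>
    have "\<delta> * (\<theta> ^ j k * D k) \<le> G * norm (x (Suc k) - x k)" for k
    proof -
      have "lev k \<le> f (line_point \<theta> (p k) (x k) (j k))"
        by (subst lev) simp
      moreover have "Df (x k) \<bullet> (x (Suc k) - x k) + f (x k) - lev k \<le> 0"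
        using x_Suc_in by (auto simp: H)
      moreover have "- (Df (x k) \<bullet> (x (Suc k) - x k)) \<le> G * norm (x (Suc k) - x k)"
        using Df_le[of k "x (Suc k) - x k"] by linarith
      ultimately show ?thesis using accepted[of k] by simp
    qed
    then show "\<forall>\<^sub>F k in sequentially. \<theta> ^ j k * D k \<le> G * norm (x (Suc k) - x k) / \<delta>"
      using assms(11) by (simp add: le_divide_eq mult.commute)
    show "\<forall>\<^sub>F k in sequentially. 0 \<le> \<theta> ^ j k * D k"
      using D0 assms(9) by (simp add: less_imp_le)
    show "(\<lambda>k. G * norm (x (Suc k) - x k) / \<delta>) \<longlonglongrightarrow> 0"
      using tendsto_divide[OF tendsto_mult_left[OF steps, of G] tendsto_const[of \<delta>]] assms(11) by simp
  qed simp
  then have lim: "(\<lambda>k. \<beta>hi * (\<theta> ^ j k * D k)) \<longlonglongrightarrow> 0"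
    by (rule tendsto_mult_right_zero)
  have le: "\<theta> ^ j k * (r k)\<^sup>2 \<le> \<beta>hi * (\<theta> ^ j k * D k)" for k
    using mult_left_mono[OF r_D[of k], of "\<theta> ^ j k"] assms(9) by (simp add: mult_ac)
  have \<alpha>r: "(\<lambda>k. \<theta> ^ j k * (r k)\<^sup>2) \<longlonglongrightarrow> 0"
    by (rule tendsto_sandwich[OF _ _ tendsto_const lim]) (use le assms(9) in simp_all)

  \<comment> \<open>The residuals vanish\<close>
  have r_lim: "r \<longlonglongrightarrow> 0"
  proof (rule order_tendstoI)
    fix a :: real assume "a < 0"
    then show "\<forall>\<^sub>F k in sequentially. a < r k"
      using r0 by (simp add: less_trans)
  next
    fix \<epsilon> :: real assume \<epsilon>: "0 < \<epsilon>"
    define B where "B = cball (0::'a) (X + \<beta>hi * G)"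
    \<comment> \<open>This tolerance is the gradient gap that a rejected trial enforces when
      \<open>r k\<close> is at least \<epsilon>.\<close>
    have "0 < (1 - \<delta>) * \<epsilon> / \<beta>hi"
      using \<epsilon> assms(12-14) by simp
    then obtain \<eta> where \<eta>: "0 < \<eta>"
      and uc: "\<And>y z. y \<in> B \<Longrightarrow> z \<in> B \<Longrightarrow> dist z y < \<eta> \<Longrightarrow> dist (Df z) (Df y) < (1 - \<delta>) * \<epsilon> / \<beta>hi"
      using assms(6)[of B] unfolding uniformly_continuous_on_def B_def by (metis bounded_cball)
    \<comment> \<open>If \<open>r k\<close> were at least \<epsilon>, the first threshold would
      exclude a full step, \<open>j k = 0\<close>, and the second would contradict rejection of the
      trial before the accepted one.\<close>
    have "\<forall>\<^sub>F k in sequentially. \<theta> ^ j k * (r k)\<^sup>2 < min (\<epsilon>\<^sup>2) (\<theta> * \<eta> * \<epsilon>)"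
      using \<epsilon> \<eta> assms(9) by (intro order_tendstoD(2)[OF \<alpha>r]) auto
    then show "\<forall>\<^sub>F k in sequentially. r k < \<epsilon>"
    proof eventually_elim
      case (elim k)
      show "r k < \<epsilon>"
      proof (rule ccontr)
        assume "\<not> r k < \<epsilon>"
        then have r\<epsilon>: "\<epsilon> \<le> r k" by simp
        have "\<epsilon>\<^sup>2 \<le> (r k)\<^sup>2"
          using r\<epsilon> \<epsilon> by (intro power_mono) auto
        then have "j k \<noteq> 0"
          using elim by (intro notI) simp
        then obtain i where i: "j k = Suc i" by (auto simp: gr0_conv_Suc)
        define y where "y = line_point \<theta> (p k) (x k) i"
        have rej: "f (x k) - \<delta> * \<theta> ^ i * (Df (x k) \<bullet> (x k - p k)) < f y"
          using not_less_Least[of i "\<lambda>i. f (line_point \<theta> (p k) (x k) i) \<le> f (x k) - \<delta> * \<theta> ^ i * D k"] i j[of k]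
          by (simp add: y_def D_def)
        have "(1 - \<delta>) * D k \<le> norm (Df (x k) - Df y) * r k"
          unfolding D_def r_def y_def
          by (rule rejected_trial_gradient_gap[OF assms(4,5,9) rej[unfolded y_def]])
        then have "\<beta>hi * ((1 - \<delta>) * D k) \<le> \<beta>hi * (norm (Df (x k) - Df y) * r k)"
          using assms(13,14) by (intro mult_left_mono) auto
        moreover have "(1 - \<delta>) * (r k)\<^sup>2 \<le> (1 - \<delta>) * (\<beta>hi * D k)"
          using assms(12) r_D by (intro mult_left_mono) auto
        ultimately have "(1 - \<delta>) * r k * r k \<le> \<beta>hi * norm (Df (x k) - Df y) * r k"
          by (simp add: power2_eq_square mult_ac)
        then have "(1 - \<delta>) * r k \<le> \<beta>hi * norm (Df (x k) - Df y)"
          using r0[of k] by simp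
        moreover have "(1 - \<delta>) * \<epsilon> \<le> (1 - \<delta>) * r k"
          using assms(12) r\<epsilon> by (intro mult_left_mono) auto
        ultimately have gap: "(1 - \<delta>) * \<epsilon> / \<beta>hi \<le> dist (Df (x k)) (Df y)"
          using assms(13,14) by (simp add: divide_le_eq dist_norm mult.commute)
        have dist_y: "dist (x k) y = \<theta> ^ i * r k"
          using assms(9) norm_minus_commute[of "p k" "x k"]
          by (simp add: y_def line_point_eq dist_norm r_def)
        have "\<theta> ^ i * r k \<le> 1 * r k"
          using assms(9,10) r0[of k] by (intro mult_right_mono power_le_one) auto
        then have "norm y \<le> X + \<beta>hi * G"
          using dist_y X[of k] r_bound[of k] norm_triangle_ineq2[of y "x k"]
          by (simp add: dist_norm norm_minus_commute)
        then have "y \<in> B" by (simp add: B_def)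
        moreover have "x k \<in> B"
          using X[of k] r0[of k] r_bound[of k] by (simp add: B_def)
        \<comment> \<open>Contrapositive of uniform continuity: where the gradients differ this
          much, the points are at least \<eta> apart.\<close>
        ultimately have "\<eta> \<le> \<theta> ^ i * r k"
          using uc[of y "x k"] gap dist_y by force
        then have "\<theta> * \<eta> * \<epsilon> \<le> \<theta> * (\<theta> ^ i * r k) * r k"
          using r\<epsilon> \<epsilon> \<eta> assms(9) by (intro mult_mono) auto
        then show False
          using elim by (simp add: i power2_eq_square mult_ac)
      qed
    qed
  qed

  \<comment> \<open>Approximate optimality of the iterates\<close>
  have near_opt: "f (x k) - f y \<le> r k * (norm (y - x k) + r k) / \<beta>lo + G * r k" if "y \<in> C" for k y
  proof -
    have "(x k - \<beta> k *\<^sub>R Df (x k) - p k) \<bullet> (y - p k) \<le> 0"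
      unfolding p_def using assms(2,3) that by (rule metric_proj_obtuse)
    then have "- \<beta> k * (Df (x k) \<bullet> (y - p k)) \<le> - ((x k - p k) \<bullet> (y - p k))"
      by (simp add: algebra_simps)
    also have "\<dots> \<le> r k * norm (y - p k)"
      unfolding r_def using Cauchy_Schwarz_ineq2[of "x k - p k" "y - p k"] by linarith
    also have "\<dots> \<le> r k * (norm (y - x k) + r k)"
      unfolding r_def using norm_triangle_ineq[of "y - x k" "x k - p k"]
      by (intro mult_left_mono) auto
    finally have "- (Df (x k) \<bullet> (y - p k)) \<le> r k * (norm (y - x k) + r k) / \<beta> k"
      using \<beta>[of k] by (simp add: le_divide_eq mult.commute)
    \<comment> \<open>The positive lower bound on the step sizes makes the estimate uniform in
      \<open>k\<close>.\<close>
    also have "\<dots> \<le> r k * (norm (y - x k) + r k) / \<beta>lo"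
      using \<beta>[of k] assms(13) r0[of k]
      by (intro divide_left_mono mult_nonneg_nonneg add_nonneg_nonneg) auto
    finally have 1: "- (Df (x k) \<bullet> (y - p k)) \<le> r k * (norm (y - x k) + r k) / \<beta>lo" .
    have 2: "Df (x k) \<bullet> (x k - p k) \<le> G * r k"
      using Df_le[of k "x k - p k"] by (simp add: r_def)
    have "f (x k) + Df (x k) \<bullet> (y - x k) \<le> f y"
      by (rule grad_ineq)
    with 1 2 show ?thesis by (simp add: inner_diff_right)
  qed

  \<comment> \<open>Claim (iii): weak cluster points\<close>
  have cluster: "l \<in> S" if cluster_l: "weak_cluster_point x l" for l
  proof -
    obtain q where q: "strict_mono q" and wl: "weakly_converges_to (x \<circ> q) l"
      using cluster_l by (auto simp: weak_cluster_point_def)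
    have "l \<in> C"
      by (rule weak_limit_in_closed_convex[OF assms(2,3) wl]) (simp add: x_C)
    moreover have "f l \<le> f y" if y: "y \<in> C" for y
    proof -
      \<comment> \<open>The bound of \<open>near_opt\<close> with \<open>norm (y - x k)\<close>
        replaced by a constant, hence a null sequence.\<close>
      define b where "b k = r k * (norm y + X + r k) / \<beta>lo + G * r k" for k
      have "b \<longlonglongrightarrow> 0 * (norm y + X + 0) / \<beta>lo + G * 0"
        unfolding b_def using assms(13) by (intro tendsto_intros r_lim) auto
      then have b: "b \<longlonglongrightarrow> 0" by simp
      have fb: "f (x k) - f y \<le> b k" for k
      proof -
        have "norm (y - x k) \<le> norm y + X"
          using norm_triangle_ineq4[of y "x k"] X[of k] by linarith
        then have "r k * (norm (y - x k) + r k) / \<beta>lo \<le> r k * (norm y + X + r k) / \<beta>lo"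
          using r0[of k] assms(13) by (intro divide_right_mono mult_left_mono) auto
        with near_opt[OF y, of k] show ?thesis by (simp add: b_def)
      qed
      \<comment> \<open>Weak lower semicontinuity through the linearisation at \<open>l\<close>
        itself: its half-spaces pass to the weak limit, and at \<open>l\<close> it equals
        \<open>f l\<close>.\<close>
      have "Df l \<bullet> l \<le> f y + 0 - f l + Df l \<bullet> l"
      proof (rule weak_limit_halfspace[OF wl])
        show "Df l \<bullet> (x \<circ> q) n \<le> f y + b (q n) - f l + Df l \<bullet> l" for n
          using grad_ineq[of l "x (q n)"] fb[of "q n"] by (simp add: inner_diff_right)
        show "(\<lambda>n. f y + b (q n) - f l + Df l \<bullet> l) \<longlonglongrightarrow> f y + 0 - f l + Df l \<bullet> l"
          using LIMSEQ_subseq_LIMSEQ[OF b q] by (intro tendsto_intros) (simp add: o_def)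
      qed
      then show ?thesis by simp
    qed
    ultimately show ?thesis
      by (simp add: S_def solution_set_def)
  qed

  show ?thesis
    using S_H S_W S_C ball cluster by (auto simp: S_def)
qed

end
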